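(* Let $H\in(0,1)$, and let $a_0\le i\le a_1$ be fixed integers. Let $\{X_1(t)\}_{t\in\mathbb{Z}}$ be a fractional Gaussian noise with Hurst parameter $H$ and unit variance. For $\delta\ge 0$ let $Y_1(t)=X_1(t)+\delta\, I_{\{a_0\le t\le a_1\}}$, and for integers $L\ge 1$ let $$Y_L(i)=L^{-H}\sum_{j=0}^{L-1}Y_1(i-j).$$ Write $P_0$ for probability when the shift is $0$ and $P_1$ for probability when the shift is $\delta$. For $\alpha\in(0,1)$ let $C_\alpha=\Phi^{-1}(1-\alpha/2)$, and for $L\ge 2$ let $C_\alpha^M=C_\alpha^M(L)>0$ be the two-scale threshold defined by $$P_0\bigl(\max(|Y_1(i)|,|Y_L(i)|)>C_\alpha^M\bigr)=\alpha .$$ Define $$\beta_{(1,L)}=P_1\bigl(\max(|Y_1(i)|,|Y_L(i)|)>C_\alpha^M\bigr),\quad \beta_1=P_1(|Y_1(i)|>C_\alpha),\quad \beta_L=P_1(|Y_L(i)|>C_\alpha).$$ Then for every $\delta>0$ there exist $\alpha_\delta\in(0,1)$ and $L_\delta>0$ such that for all $\alpha\in(0,\alpha_\delta)$ and all integers $L\ge 2$ with $L>L_\delta$, $$\beta_{(1,L)}\ \ge\ \frac{\beta_1+\beta_L}{2}.$$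
   Context: A fractional Gaussian noise with Hurst parameter $H\in(0,1)$ and unit variance is a mean-zero stationary Gaussian sequence with autocovariance $\gamma(h)=\tfrac12\{|h+1|^{2H}-2|h|^{2H}+|h-1|^{2H}\}$; equivalently, it is the increment sequence $B_H(t+1)-B_H(t)$ of a fractional Brownian motion $B_H$ (the Gaussian process with mean $0$ and $E[B_H(s)B_H(t)]=\tfrac12(|s|^{2H}+|t|^{2H}-|s-t|^{2H})$). $\Phi$ is the standard normal distribution function. $I$ denotes an indicator. The constants $\alpha_\delta$ and $L_\delta$ may depend on the fixed data $H,a_0,a_1,i$ as well as on $\delta$. *)

theory Defs
  imports "HOL-Probability.Probability"
begin

text \<open>Point masses are the degenerate normal laws with variance zero.\<close>

definition gaussian_rv :: "'a measure \<Rightarrow> ('a \<Rightarrow> real) \<Rightarrow> bool" where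
  "gaussian_rv M Z \<longleftrightarrow>
     Z \<in> borel_measurable M \<and>
     ((\<exists>\<mu>. AE \<omega> in M. Z \<omega> = \<mu>) \<or>
      (\<exists>\<mu> \<sigma>. \<sigma> > 0 \<and> distributed M lborel Z (\<lambda>x. ennreal (normal_density \<mu> \<sigma> x))))"

definition gaussian_process :: "'a measure \<Rightarrow> ('t \<Rightarrow> 'a \<Rightarrow> real) \<Rightarrow> bool" where
  "gaussian_process M X \<longleftrightarrow>
     prob_space M \<and>
     (\<forall>S c. finite S \<longrightarrow> gaussian_rv M (\<lambda>\<omega>. \<Sum>t\<in>S. c t * X t \<omega>))"

definition fgn_autocov :: "real \<Rightarrow> int \<Rightarrow> real" where
  "fgn_autocov H h =
     (\<bar>real_of_int (h + 1)\<bar> powr (2 * H) - 2 * \<bar>real_of_int h\<bar> powr (2 * H)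
        + \<bar>real_of_int (h - 1)\<bar> powr (2 * H)) / 2"

text \<open>The mean is constant and the covariance depends on the lag only, which for a
  Gaussian process is stationarity. The variance is \<open>fgn_autocov H 0 = 1\<close>.\<close>

definition fractional_gaussian_noise ::
    "real \<Rightarrow> 'a measure \<Rightarrow> (int \<Rightarrow> 'a \<Rightarrow> real) \<Rightarrow> bool" where
  "fractional_gaussian_noise H M X \<longleftrightarrow>
     gaussian_process M X \<and>
     (\<forall>t. integral\<^sup>L M (X t) = 0) \<and>
     (\<forall>t h. integral\<^sup>L M (\<lambda>\<omega>. X (t + h) \<omega> * X t \<omega>) = fgn_autocov H h)"

definition mean_shift ::
    "int \<Rightarrow> int \<Rightarrow> real \<Rightarrow> (int \<Rightarrow> 'a \<Rightarrow> real) \<Rightarrow> int \<Rightarrow> 'a \<Rightarrow> real" where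
  "mean_shift a0 a1 \<delta> X t \<omega> = X t \<omega> + \<delta> * indicator {a0..a1} t"

definition aggregate ::
    "real \<Rightarrow> nat \<Rightarrow> (int \<Rightarrow> 'a \<Rightarrow> real) \<Rightarrow> int \<Rightarrow> 'a \<Rightarrow> real" where
  "aggregate H L Y i \<omega> = real L powr (- H) * (\<Sum>j<L. Y (i - int j) \<omega>)"

definition std_normal_cdf :: "real \<Rightarrow> real" where
  "std_normal_cdf = cdf std_normal_distribution"

text \<open>The normal distribution function is strictly increasing with range the open unit
  interval, so \<open>inv\<close> gives its genuine inverse at \<open>1 - \<alpha> / 2\<close> for \<open>0 < \<alpha> < 1\<close>.\<close>

definition one_scale_threshold :: "real \<Rightarrow> real" where
  "one_scale_threshold \<alpha> = inv std_normal_cdf (1 - \<alpha> / 2)"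

definition one_scale_prob :: "'a measure \<Rightarrow> ('a \<Rightarrow> real) \<Rightarrow> real \<Rightarrow> real" where
  "one_scale_prob M U c = measure M {\<omega> \<in> space M. \<bar>U \<omega>\<bar> > c}"

definition two_scale_prob ::
    "'a measure \<Rightarrow> ('a \<Rightarrow> real) \<Rightarrow> ('a \<Rightarrow> real) \<Rightarrow> real \<Rightarrow> real" where
  "two_scale_prob M U V c = measure M {\<omega> \<in> space M. max \<bar>U \<omega>\<bar> \<bar>V \<omega>\<bar> > c}"

end

(* The maximum test is compared only through its event |Y_1(i)| > C: since its critical value C
   satisfies a <= 4 T(C), where a is the level and T the upper normal tail, and D = C_a satisfies
   a = 2 T(D), the Bonferroni bound T(C) >= T(D)/2 suffices and the dependence between the two
   scales plays no role.  Shifting by d tilts the normal density by exp(d t - d^2/2), which grows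
   with t and so favours the half of the mass beyond C over the half between D and C.  Hence
   2 T(C - d) - T(D - d) is at least a constant times exp(-D^2/2 + 3 d D/4).  For large D this
   dominates the remaining terms, which are O(exp(-D^2/2 + d D/2)) because the mean of Y_L(i) is
   O(L^(-H)) and hence at most d/2 for large L. *)

theory Submission
  imports Defs
begin

section \<open>Translation of the standard normal law as exponential tilting\<close>

abbreviation stdN :: "real measure" where "stdN \<equiv> std_normal_distribution"

definition normal_tail :: "real \<Rightarrow> real" where
  "normal_tail x = measure stdN {x<..}"

interpretation stdN: prob_space stdN
  by (rule prob_space_normal_density) simp

lemma std_normal_density_shift:
  "std_normal_density (t - d) = std_normal_density t * exp (d * t - d\<^sup>2 / 2)"
  by (simp add: std_normal_density_def exp_add[symmetric] exp_diff[symmetric] field_simps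
      power2_eq_square)

text \<open>The Cameron-Martin formula in dimension one: substituting t - d for t in the Lebesgue
  integral moves the translation from the set to the density, where it appears as the weight exp(d t
  - d^2/2).\<close>

lemma emeasure_stdN_shift:
  fixes A :: "real set" and d :: real
  assumes [measurable]: "A \<in> sets borel"
  shows "emeasure stdN {t. t + d \<in> A}
    = (\<integral>\<^sup>+t. ennreal (exp (d * t - d\<^sup>2 / 2)) * indicator A t \<partial>stdN)"
proof -
  have "emeasure stdN {t. t + d \<in> A}
      = (\<integral>\<^sup>+t. ennreal (std_normal_density t) * indicator A (t + d) \<partial>lborel)"
    by (subst emeasure_density) (auto intro!: nn_integral_cong simp: indicator_def)
  also have "\<dots> = (\<integral>\<^sup>+t. ennreal (std_normal_density (t - d)) * indicator A t \<partial>lborel)"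
    by (subst (2) nn_integral_real_affine[where c=1 and t=d]) (auto simp: add.commute)
  also have "\<dots> = (\<integral>\<^sup>+t. ennreal (exp (d * t - d\<^sup>2 / 2)) * indicator A t \<partial>stdN)"
    by (subst nn_integral_density)
      (auto intro!: nn_integral_cong simp: std_normal_density_shift ennreal_mult' mult.assoc)
  finally show ?thesis .
qed

text \<open>A constant bound on the tilting weight over A comes out of the integral. With the
  companion lower bound below, this reduces every later tail estimate to evaluating the weight at an
  endpoint of an interval.\<close>

lemma measure_stdN_shift_le:
  fixes A :: "real set" and d b :: real
  assumes [measurable]: "A \<in> sets borel" and b: "\<And>t. t \<in> A \<Longrightarrow> exp (d * t - d\<^sup>2 / 2) \<le> b"
    and "0 \<le> b"
  shows "measure stdN {t. t + d \<in> A} \<le> b * measure stdN A"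
proof -
  have "emeasure stdN {t. t + d \<in> A} \<le> (\<integral>\<^sup>+t. ennreal b * indicator A t \<partial>stdN)"
    unfolding emeasure_stdN_shift[OF assms(1)]
    by (intro nn_integral_mono) (auto simp: indicator_def b ennreal_leI)
  also have "\<dots> = ennreal b * emeasure stdN A"
    by (subst nn_integral_cmult_indicator) auto
  finally show ?thesis
    using \<open>0 \<le> b\<close> by (simp add: stdN.emeasure_eq_measure ennreal_mult[symmetric])
qed

lemma measure_stdN_shift_ge:
  fixes A :: "real set" and d b :: real
  assumes [measurable]: "A \<in> sets borel" and b: "\<And>t. t \<in> A \<Longrightarrow> b \<le> exp (d * t - d\<^sup>2 / 2)"
    and "0 \<le> b"
  shows "b * measure stdN A \<le> measure stdN {t. t + d \<in> A}"
proof -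
  have "ennreal b * emeasure stdN A = (\<integral>\<^sup>+t. ennreal b * indicator A t \<partial>stdN)"
    by (subst nn_integral_cmult_indicator) auto
  also have "\<dots> \<le> emeasure stdN {t. t + d \<in> A}"
    unfolding emeasure_stdN_shift[OF assms(1)]
    by (intro nn_integral_mono) (auto simp: indicator_def b ennreal_leI)
  finally show ?thesis
    using \<open>0 \<le> b\<close> by (simp add: stdN.emeasure_eq_measure ennreal_mult[symmetric])
qed

section \<open>Tails, two-sided events and masses of intervals\<close>

lemma measure_stdN_lessThan: "measure stdN {..<- x} = normal_tail x"
proof -
  have "emeasure stdN {..<- x} = (\<integral>\<^sup>+t. ennreal (std_normal_density t) * indicator {..<- x} t \<partial>lborel)"
    by (subst emeasure_density) auto
  \<comment> \<open>Reflection t to -t; the density is even.\<close>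
  also have "\<dots> = (\<integral>\<^sup>+t. ennreal (std_normal_density t) * indicator {x<..} t \<partial>lborel)"
    by (subst nn_integral_real_affine[where c="-1" and t=0])
      (auto intro!: nn_integral_cong simp: std_normal_density_def indicator_def)
  also have "\<dots> = emeasure stdN {x<..}"
    by (subst emeasure_density) auto
  finally show ?thesis
    by (simp add: measure_def normal_tail_def)
qed

text \<open>For nonnegative c the event splits into two disjoint rays, and the left one is reflected
  into a right tail.\<close>

lemma measure_stdN_abs_shift_gt:
  assumes "0 \<le> c"
  shows "measure stdN {t. \<bar>t + m\<bar> > c} = normal_tail (c - m) + normal_tail (c + m)"
proof -
  have "{t. \<bar>t + m\<bar> > c} = {c - m<..} \<union> {..<- (c + m)}"
    using assms by auto
  moreover have "{c - m<..} \<inter> {..<- (c + m)} = {}"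
    using assms by auto
  ultimately show ?thesis
    by (simp only: stdN.finite_measure_Union sets_density sets_lborel greaterThan_borel lessThan_borel
        measure_stdN_lessThan normal_tail_def[of "c - m"])
qed

lemma normal_tail_antimono: "x \<le> y \<Longrightarrow> normal_tail y \<le> normal_tail x"
  unfolding normal_tail_def by (intro stdN.finite_measure_mono) auto

lemma normal_tail_le_1: "normal_tail x \<le> 1"
  by (simp add: normal_tail_def)

lemma measure_stdN_Ioc:
  "x \<le> y \<Longrightarrow> measure stdN {x<..y} = normal_tail x - normal_tail y"
proof -
  assume "x \<le> y"
  then have "{x<..} = {x<..y} \<union> {y<..}" by auto
  moreover have "{x<..y} \<inter> {y<..} = {}" by auto
  ultimately show ?thesis
    by (simp add: normal_tail_def stdN.finite_measure_Union)
qed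

text \<open>The density is positive everywhere, so a null interval for the normal law would be
  Lebesgue null, against its positive length.\<close>

lemma measure_stdN_Ioc_pos:
  assumes "x < y" shows "0 < measure stdN {x<..y}"
proof -
  have "emeasure stdN {x<..y} \<noteq> 0"
  proof
    assume "emeasure stdN {x<..y} = 0"
    then have "AE t in lborel. ennreal (std_normal_density t) * indicator {x<..y} t = 0"
      by (subst (asm) emeasure_density) (auto simp: nn_integral_0_iff_AE)
    then have "AE t in lborel. t \<notin> {x<..y}"
      by eventually_elim (use normal_density_pos[of 1 0] in
          \<open>auto simp: indicator_def ennreal_eq_0_iff not_le[symmetric] split: if_splits\<close>)
    then have "emeasure lborel {x<..y} = 0"
      by (subst (asm) AE_iff_measurable[where N="{x<..y}"]) auto
    then show False using assms by simp
  qed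
  then show ?thesis
    by (metis stdN.emeasure_eq_measure ennreal_0 less_eq_real_def measure_nonneg)
qed

text \<open>Tilt by -h: on the ray beyond x the weight decreases, so its value at x bounds
  it.\<close>

lemma normal_tail_add_le:
  assumes "0 \<le> h"
  shows "normal_tail (x + h) \<le> exp (- h * x - h\<^sup>2 / 2) * normal_tail x"
proof -
  have "{t. t + - h \<in> {x<..}} = {x + h<..}" by auto
  moreover have "measure stdN {t. t + - h \<in> {x<..}} \<le> exp (- h * x - h\<^sup>2 / 2) * measure stdN {x<..}"
  proof (rule measure_stdN_shift_le)
    fix t assume "t \<in> {x<..}"
    then have "h * x \<le> h * t" using assms by (intro mult_left_mono) auto
    then show "exp (- h * t - (- h)\<^sup>2 / 2) \<le> exp (- h * x - h\<^sup>2 / 2)" by simp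
  qed auto
  ultimately show ?thesis by (simp only: normal_tail_def)
qed

lemma normal_tail_le_exp: "0 \<le> x \<Longrightarrow> normal_tail x \<le> exp (- x\<^sup>2 / 2)"
  using order_trans[OF normal_tail_add_le[of x 0] mult_left_mono[OF normal_tail_le_1]]
  by simp

text \<open>A lower bound matching exp(-x^2/2) up to a factor exp(-x h). The interval from x to x +
  h lies in the tail and is a translate of the one from 0 to h; the tilt by x is largest at x + h,
  where its exponent is x^2/2 + x h.\<close>

lemma normal_tail_ge_exp:
  assumes "0 \<le> x"
  shows "measure stdN {0<..h} * exp (- x\<^sup>2 / 2 - x * h) \<le> normal_tail x"
proof -
  have eq: "{t. t + x \<in> {x<..x + h}} = {0<..h}" by auto
  have "measure stdN {0<..h} \<le> exp (x\<^sup>2 / 2 + x * h) * measure stdN {x<..x + h}"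
    unfolding eq[symmetric] using assms
  proof (intro measure_stdN_shift_le)
    fix t assume "t \<in> {x<..x + h}"
    then have "x * t \<le> x * (x + h)" using assms by (intro mult_left_mono) auto
    then show "exp (x * t - x\<^sup>2 / 2) \<le> exp (x\<^sup>2 / 2 + x * h)"
      by (simp add: power2_eq_square algebra_simps)
  qed auto
  also have "\<dots> \<le> exp (x\<^sup>2 / 2 + x * h) * normal_tail x"
    unfolding normal_tail_def by (intro mult_left_mono stdN.finite_measure_mono) auto
  finally have "measure stdN {0<..h} * exp (- x\<^sup>2 / 2 - x * h)
      \<le> exp (x\<^sup>2 / 2 + x * h) * normal_tail x * exp (- x\<^sup>2 / 2 - x * h)"
    by (intro mult_right_mono) auto
  also have "\<dots> = normal_tail x * exp ((x\<^sup>2 / 2 + x * h) + (- x\<^sup>2 / 2 - x * h))"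
    by (simp only: exp_add mult_ac)
  finally show ?thesis by simp
qed

section \<open>Comparison of shifted tails\<close>

text \<open>By \<open>half\<close>, the mass between D and c is at most the mass beyond c. Under the
  increasing weight w(t) = exp(d t - d^2/2) the former counts at most w(c) per unit, the latter at
  least w(c), and at least w(c + h) past c + h. The surplus w(c + h) - w(c) on that far tail
  survives the subtraction.\<close>

lemma normal_tail_shift_gain:
  assumes "0 \<le> d" "0 \<le> h" "D \<le> c" and half: "normal_tail D \<le> 2 * normal_tail c"
  shows "(exp (d * (c + h) - d\<^sup>2 / 2) - exp (d * c - d\<^sup>2 / 2)) * normal_tail (c + h)
    \<le> 2 * normal_tail (c - d) - normal_tail (D - d)"
proof -
  let ?w = "\<lambda>t. exp (d * t - d\<^sup>2 / 2)"
  have s1: "{t. t + d \<in> {c<..c + h}} = {c - d<..c + h - d}"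
    and s2: "{t. t + d \<in> {c + h<..}} = {c + h - d<..}"
    and s3: "{t. t + d \<in> {D<..c}} = {D - d<..c - d}" by auto
  have "?w c * measure stdN {c<..c + h} \<le> measure stdN {c - d<..c + h - d}"
    unfolding s1[symmetric] using assms
    by (intro measure_stdN_shift_ge) (auto intro!: mult_left_mono)
  then have 1: "?w c * (normal_tail c - normal_tail (c + h))
      \<le> normal_tail (c - d) - normal_tail (c + h - d)"
    using assms by (simp add: measure_stdN_Ioc)
  have 2: "?w (c + h) * normal_tail (c + h) \<le> normal_tail (c + h - d)"
    unfolding normal_tail_def s2[symmetric] using assms
    by (intro measure_stdN_shift_ge) (auto intro!: mult_left_mono)
  have "measure stdN {D - d<..c - d} \<le> ?w c * measure stdN {D<..c}"
    unfolding s3[symmetric] using assms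
    by (intro measure_stdN_shift_le) (auto intro!: mult_left_mono)
  also have "\<dots> \<le> ?w c * normal_tail c"
    using assms by (intro mult_left_mono) (auto simp: measure_stdN_Ioc)
  finally have 3: "normal_tail (D - d) - normal_tail (c - d) \<le> ?w c * normal_tail c"
    using assms by (simp add: measure_stdN_Ioc)
  show ?thesis
    using 1 2 3 by (simp add: algebra_simps)
qed

text \<open>Here D stands for the one-scale critical value, c for the two-scale one and m for the
  mean of the shifted aggregate. The term with D - d is absorbed by the gain of
  \<open>normal_tail_shift_gain\<close>; the other three are at most the tail at D - d/2, which the
  gain dominates for large D.\<close>

lemma two_scale_tail_comparison:
  fixes d :: real
  assumes "0 < d"
  obtains C0 where "0 < C0"
    and "\<And>D c m. \<lbrakk>C0 \<le> D; D \<le> c; normal_tail D \<le> 2 * normal_tail c; 0 \<le> m; m \<le> d / 2\<rbrakk>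
      \<Longrightarrow> normal_tail (D - d) + normal_tail (D + d) + (normal_tail (D - m) + normal_tail (D + m))
        \<le> 2 * normal_tail (c - d)"
proof -
  \<comment> \<open>The lower bound for the tail at D + 2 h costs a factor exp(-3 h D) relative to
    exp(-D^2/2). With 3 h = d/4 the gain keeps exp(3 d D/4), still exp(d D/4) ahead of the exp(d
    D/2) in the bound for the tail at D - d/2.\<close>
  define h where "h = d / 12"
  define k where "k = measure stdN {0<..h}"
  have "0 < h" using assms by (simp add: h_def)
  have "0 < k" using \<open>0 < h\<close> by (simp add: k_def measure_stdN_Ioc_pos)
  have "filterlim (\<lambda>D. exp (d / 4 * D)) at_top at_top"
    using assms
    by (intro filterlim_compose[OF exp_at_top] filterlim_tendsto_pos_mult_at_top[OF tendsto_const])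
      (auto simp: filterlim_ident)
  then have "eventually (\<lambda>D. 3 * exp (3 * d\<^sup>2 / 8 + 4 * h\<^sup>2) / (d * h * k) \<le> exp (d / 4 * D)) at_top"
    by (simp add: filterlim_at_top)
  then obtain C1 where C1: "\<And>D. C1 \<le> D \<Longrightarrow>
      3 * exp (3 * d\<^sup>2 / 8 + 4 * h\<^sup>2) / (d * h * k) \<le> exp (d / 4 * D)"
    by (auto simp: eventually_at_top_linorder)
  \<comment> \<open>\<open>C1\<close> makes the gain exceed three tails; d/2 makes D - d/2
    nonnegative for \<open>normal_tail_le_exp\<close>; 1/h gives h D >= 1, hence exp(h D) >=
    2.\<close>
  define C0 where "C0 = max C1 (max (d / 2) (1 / h))"
  show thesis
  proof (rule that)
    show "0 < C0" using \<open>0 < h\<close> by (auto simp: C0_def less_max_iff_disj)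
    fix D c m
    assume D: "C0 \<le> D" and "D \<le> c" and half: "normal_tail D \<le> 2 * normal_tail c"
      and m: "0 \<le> m" "m \<le> d / 2"
    have D': "C1 \<le> D" "d / 2 \<le> D" "1 / h \<le> D" using D by (auto simp: C0_def)
    have "0 < D" using D' \<open>0 < d\<close> by linarith
    have tD: "0 < normal_tail D"
      using less_le_trans[OF _ normal_tail_ge_exp[of D h]] \<open>0 < D\<close> \<open>0 < k\<close> by (simp add: k_def)
    \<comment> \<open>Moving from D to D + h already cuts the tail by more than half, so
      \<open>half\<close> keeps c within h of D. Hence the tail at c + h is at least the one at D +
      2 h.\<close>
    have "c < D + h"
    proof (rule ccontr)
      assume "\<not> c < D + h"
      then have "2 * normal_tail c \<le> 2 * (exp (- h * D - h\<^sup>2 / 2) * normal_tail D)"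
        using normal_tail_antimono[of "D + h" c] normal_tail_add_le[of h D] \<open>0 < h\<close> by simp
      moreover have "2 * exp (- h * D - h\<^sup>2 / 2) < 1"
      proof -
        have "1 \<le> h * D" using D' \<open>0 < h\<close> by (simp add: field_simps)
        then have "2 \<le> exp (h * D)" using exp_ge_add_one_self[of "h * D"] by linarith
        also have "\<dots> < exp (h * D + h\<^sup>2 / 2)" using \<open>0 < h\<close> by simp
        finally have "2 < exp (h * D + h\<^sup>2 / 2)" .
        then have "2 * exp (- (h * D + h\<^sup>2 / 2)) < 1"
          unfolding exp_minus by (simp add: pos_divide_less_eq flip: divide_inverse)
        then show ?thesis by simp
      qed
      then have "2 * (exp (- h * D - h\<^sup>2 / 2)) * normal_tail D < 1 * normal_tail D"
        using tD by (intro mult_strict_right_mono)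
      ultimately show False using half by simp
    qed
    have "3 * normal_tail (D - d / 2) \<le> 3 * exp (- (D - d / 2)\<^sup>2 / 2)"
      using normal_tail_le_exp[of "D - d / 2"] D' by simp
    also have "\<dots> \<le> d * h * k * exp (d / 4 * D - 3 * d\<^sup>2 / 8 - 4 * h\<^sup>2) * exp (- (D - d / 2)\<^sup>2 / 2)"
    proof (rule mult_right_mono)
      have "3 * exp (3 * d\<^sup>2 / 8 + 4 * h\<^sup>2) \<le> d * h * k * exp (d / 4 * D)"
        using C1[OF D'(1)] \<open>0 < d\<close> \<open>0 < h\<close> \<open>0 < k\<close>
        by (subst (asm) pos_divide_le_eq) (auto simp: mult_ac)
      then have "3 * exp (3 * d\<^sup>2 / 8 + 4 * h\<^sup>2) * exp (- (3 * d\<^sup>2 / 8 + 4 * h\<^sup>2))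
          \<le> d * h * k * exp (d / 4 * D) * exp (- (3 * d\<^sup>2 / 8 + 4 * h\<^sup>2))"
        by (intro mult_right_mono) auto
      then show "3 \<le> d * h * k * exp (d / 4 * D - 3 * d\<^sup>2 / 8 - 4 * h\<^sup>2)"
        by (simp add: mult.assoc exp_add[symmetric] algebra_simps)
    qed simp
    also have "\<dots> = d * h * k * exp ((d / 4 * D - 3 * d\<^sup>2 / 8 - 4 * h\<^sup>2) - (D - d / 2)\<^sup>2 / 2)"
      by (simp add: mult.assoc exp_add[symmetric])
    \<comment> \<open>Expanding both squares, the two sides agree because 3 h D = d D/4.\<close>
    also have "(d / 4 * D - 3 * d\<^sup>2 / 8 - 4 * h\<^sup>2) - (D - d / 2)\<^sup>2 / 2
        = (d * D - d\<^sup>2 / 2) + (- (D + 2 * h)\<^sup>2 / 2 - (D + 2 * h) * h)"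
      by (simp add: h_def power2_eq_square field_simps)
    also have "d * h * k * exp \<dots> = exp (d * D - d\<^sup>2 / 2) * (d * h)
        * (k * exp (- (D + 2 * h)\<^sup>2 / 2 - (D + 2 * h) * h))"
      by (simp only: exp_add mult_ac)
    \<comment> \<open>Factor by factor: D <= c in the weight, exp(x) - 1 >= x at x = d h, and the
      lower tail bound at D + 2 h.\<close>
    also have "\<dots> \<le> exp (d * c - d\<^sup>2 / 2) * (exp (d * h) - 1) * normal_tail (c + h)"
    proof (intro mult_mono)
      have "k * exp (- (D + 2 * h)\<^sup>2 / 2 - (D + 2 * h) * h) \<le> normal_tail (D + 2 * h)"
        unfolding k_def using \<open>0 < D\<close> \<open>0 < h\<close> by (intro normal_tail_ge_exp) auto
      also have "\<dots> \<le> normal_tail (c + h)"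
        using \<open>c < D + h\<close> by (intro normal_tail_antimono) auto
      finally show "k * exp (- (D + 2 * h)\<^sup>2 / 2 - (D + 2 * h) * h) \<le> normal_tail (c + h)" .
      show "d * h \<le> exp (d * h) - 1" using exp_ge_add_one_self[of "d * h"] by linarith
    qed (use \<open>0 < d\<close> \<open>0 < h\<close> \<open>0 < k\<close> \<open>D \<le> c\<close> in simp_all)
    also have "\<dots> = (exp (d * (c + h) - d\<^sup>2 / 2) - exp (d * c - d\<^sup>2 / 2)) * normal_tail (c + h)"
    proof -
      have "d * (c + h) - d\<^sup>2 / 2 = (d * c - d\<^sup>2 / 2) + d * h" by (simp add: distrib_left)
      then show ?thesis by (simp only: exp_add right_diff_distrib mult_1_right)
    qed
    also have "\<dots> \<le> 2 * normal_tail (c - d) - normal_tail (D - d)"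
      using normal_tail_shift_gain[of d h D c] \<open>0 < d\<close> \<open>0 < h\<close> \<open>D \<le> c\<close> half by simp
    finally have "3 * normal_tail (D - d / 2) \<le> 2 * normal_tail (c - d) - normal_tail (D - d)" .
    moreover have "normal_tail (D + d) \<le> normal_tail (D - d / 2)"
      "normal_tail (D - m) \<le> normal_tail (D - d / 2)"
      "normal_tail (D + m) \<le> normal_tail (D - d / 2)"
      using m \<open>0 < d\<close> by (auto intro!: normal_tail_antimono)
    ultimately show "normal_tail (D - d) + normal_tail (D + d)
        + (normal_tail (D - m) + normal_tail (D + m)) \<le> 2 * normal_tail (c - d)"
      by linarith
  qed
qed

section \<open>The one-scale threshold\<close>

lemma std_normal_cdf_eq: "std_normal_cdf x = 1 - normal_tail x"
proof -
  have "- {x<..} = {..x}" by auto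
  then show ?thesis
    using stdN.prob_compl[of "{x<..}"]
    by (simp add: std_normal_cdf_def cdf_def normal_tail_def Compl_eq_Diff_UNIV[symmetric])
qed

text \<open>\<open>inv\<close> returns a genuine preimage once 1 - a/2 is known to lie in the range.
  The intermediate value theorem shows this, using the limits 0 and 1 and continuity, which holds
  because the law has no atoms.\<close>

lemma normal_tail_one_scale_threshold:
  assumes "0 < a" "a < 1"
  shows "normal_tail (one_scale_threshold a) = a / 2"
proof -
  interpret real_distribution stdN
    by (intro real_distribution.intro real_distribution_axioms.intro stdN.prob_space_axioms) auto
  have iso: "isCont std_normal_cdf x" for x
  proof -
    have "emeasure stdN {x} = 0"
      by (subst emeasure_density) (auto simp: nn_integral_0_iff_AE indicator_def intro!: AE_I'[of "{x}"])
    then show ?thesis by (simp add: std_normal_cdf_def isCont_cdf measure_def)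
  qed
  have "eventually (\<lambda>x. std_normal_cdf x < 1 - a / 2) at_bot"
    using order_tendstoD(2)[OF cdf_lim_at_bot, of "1 - a / 2"] assms by (simp add: std_normal_cdf_def)
  then obtain l where l: "\<And>x. x \<le> l \<Longrightarrow> std_normal_cdf x < 1 - a / 2"
    by (auto simp: eventually_at_bot_linorder)
  have "eventually (\<lambda>x. std_normal_cdf x > 1 - a / 2) at_top"
    using order_tendstoD(1)[OF cdf_lim_at_top_prob, of "1 - a / 2"] assms by (simp add: std_normal_cdf_def)
  then obtain u where u: "\<And>x. u \<le> x \<Longrightarrow> std_normal_cdf x > 1 - a / 2"
    by (auto simp: eventually_at_top_linorder)
  have "\<exists>x\<ge>l. x \<le> max l u \<and> std_normal_cdf x = 1 - a / 2"
    using l[of l] u[of "max l u"] iso by (intro IVT) auto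
  then have "1 - a / 2 \<in> range std_normal_cdf" by (metis rangeI)
  then have "std_normal_cdf (one_scale_threshold a) = 1 - a / 2"
    unfolding one_scale_threshold_def by (rule f_inv_into_f)
  then show ?thesis by (simp add: std_normal_cdf_eq)
qed

section \<open>Autocovariance sums of fractional Gaussian noise\<close>

lemma fgn_autocov_minus: "fgn_autocov H (- h) = fgn_autocov H h"
proof -
  have "\<bar>real_of_int (- h + 1)\<bar> = \<bar>real_of_int (h - 1)\<bar>"
    "\<bar>real_of_int (- h - 1)\<bar> = \<bar>real_of_int (h + 1)\<bar>" by auto
  then show ?thesis by (simp add: fgn_autocov_def)
qed

lemma fgn_autocov_0: "fgn_autocov H 0 = 1"
  by (simp add: fgn_autocov_def)

text \<open>The autocovariance is half a second difference of n powr (2 H), so its sum over the lags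
  1 to L telescopes to a first difference. The final -1 is the first difference at 0, with
  \<open>0 powr (2 * H) = 0\<close>.\<close>

lemma sum_fgn_autocov_lags:
  "2 * (\<Sum>j<L. fgn_autocov H (int L - int j)) = real (Suc L) powr (2 * H) - real L powr (2 * H) - 1"
proof -
  have "(\<Sum>j<L. fgn_autocov H (int L - int j)) = (\<Sum>m<L. fgn_autocov H (int (Suc m)))"
    by (rule sum.reindex_bij_witness[of _ "\<lambda>m. L - Suc m" "\<lambda>j. L - Suc j"]) (auto simp: of_nat_diff)
  also have "2 * \<dots> = real (Suc L) powr (2 * H) - real L powr (2 * H) - 1"
  proof (induction L)
    case (Suc L)
    have "2 * fgn_autocov H (int (Suc L)) = real (Suc (Suc L)) powr (2 * H)
        - 2 * real (Suc L) powr (2 * H) + real L powr (2 * H)"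
      by (simp add: fgn_autocov_def add_ac)
    with Suc show ?case by (simp add: distrib_left)
  qed simp
  finally show ?thesis .
qed

text \<open>Self-similarity: L consecutive increments sum to one increment of fractional Brownian
  motion over length L. In the induction the new row and column contribute equally by symmetry, and
  the diagonal entry 1 cancels the -1 of the telescoped sum.\<close>

lemma sum_fgn_autocov:
  "(\<Sum>j<L. \<Sum>k<L. fgn_autocov H (int j - int k)) = real L powr (2 * H)"
proof (induction L)
  case (Suc L)
  have "(\<Sum>j<L. fgn_autocov H (int j - int L)) = (\<Sum>j<L. fgn_autocov H (int L - int j))"
    by (intro sum.cong refl) (metis fgn_autocov_minus minus_diff_eq)
  with Suc show ?case
    using sum_fgn_autocov_lags[of H L]
    by (simp add: sum.distrib fgn_autocov_0)
qed simp

section \<open>Laws of the noise and of its aggregates\<close>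

text \<open>A point mass with mean zero sits at 0 and has second moment 0, so second moment 1 rules
  out the degenerate case.\<close>

lemma gaussian_rv_standard:
  assumes "prob_space M" "gaussian_rv M Z" "integral\<^sup>L M Z = 0" "integral\<^sup>L M (\<lambda>\<omega>. (Z \<omega>)\<^sup>2) = 1"
  shows "distributed M lborel Z std_normal_density"
proof -
  interpret prob_space M by fact
  have [measurable]: "Z \<in> borel_measurable M" using assms(2) by (simp add: gaussian_rv_def)
  from assms(2) consider (deg) \<mu> where "AE \<omega> in M. Z \<omega> = \<mu>"
    | (nondeg) \<mu> \<sigma> where "\<sigma> > 0" "distributed M lborel Z (normal_density \<mu> \<sigma>)"
    by (auto simp: gaussian_rv_def)
  then show ?thesis
  proof cases
    case deg
    have "integral\<^sup>L M Z = integral\<^sup>L M (\<lambda>_. \<mu>)"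
      by (rule integral_cong_AE) (use deg in auto)
    moreover have "integral\<^sup>L M (\<lambda>\<omega>. (Z \<omega>)\<^sup>2) = integral\<^sup>L M (\<lambda>_. \<mu>\<^sup>2)"
      by (rule integral_cong_AE) (use deg in auto)
    ultimately show ?thesis using assms by (simp add: prob_space)
  next
    case nondeg
    have "\<mu> = 0" using normal_distributed_expectation[OF nondeg] assms by simp
    moreover have "\<sigma>\<^sup>2 = 1" using normal_distributed_variance[OF nondeg] assms by simp
    then have "\<sigma> = 1" using nondeg by (simp add: power2_eq_1_iff)
    ultimately show ?thesis using nondeg by simp
  qed
qed

lemma one_scale_prob_std_normal:
  assumes "prob_space M" "distributed M lborel Z std_normal_density" "0 \<le> c"
  shows "one_scale_prob M (\<lambda>\<omega>. Z \<omega> + m) c = normal_tail (c - m) + normal_tail (c + m)"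
proof -
  interpret prob_space M by fact
  have [measurable]: "Z \<in> borel_measurable M" using assms(2) by (simp add: distributed_def)
  have "stdN = distr M lborel Z" using assms(2) by (simp add: distributed_def)
  moreover have "measure (distr M lborel Z) {t. \<bar>t + m\<bar> > c} = one_scale_prob M (\<lambda>\<omega>. Z \<omega> + m) c"
    by (subst measure_distr) (auto simp: one_scale_prob_def intro!: arg_cong[of _ _ "measure M"])
  ultimately show ?thesis using measure_stdN_abs_shift_gt[OF assms(3)] by metis
qed

lemma fgn_gaussian_rv:
  assumes "fractional_gaussian_noise H M X" "finite S"
  shows "gaussian_rv M (\<lambda>\<omega>. \<Sum>t\<in>S. c t * X t \<omega>)"
  using assms by (simp add: fractional_gaussian_noise_def gaussian_process_def)

lemma fgn_covariance:
  assumes "fractional_gaussian_noise H M X"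
  shows "integral\<^sup>L M (\<lambda>\<omega>. X s \<omega> * X t \<omega>) = fgn_autocov H (s - t)"
proof -
  have "integral\<^sup>L M (\<lambda>\<omega>. X (t + (s - t)) \<omega> * X t \<omega>) = fgn_autocov H (s - t)"
    using assms unfolding fractional_gaussian_noise_def by (elim conjE allE) assumption
  then show ?thesis by simp
qed

lemma fgn_square_integrable:
  assumes "fractional_gaussian_noise H M X"
  shows "X t \<in> borel_measurable M" "integrable M (\<lambda>\<omega>. (X t \<omega>)\<^sup>2)"
proof -
  have "gaussian_rv M (\<lambda>\<omega>. \<Sum>s\<in>{t}. 1 * X s \<omega>)"
    by (rule fgn_gaussian_rv[OF assms]) simp
  then show "X t \<in> borel_measurable M" by (simp add: gaussian_rv_def)
  have "integral\<^sup>L M (\<lambda>\<omega>. (X t \<omega>)\<^sup>2) = 1"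
    using fgn_covariance[OF assms, of t t] by (simp add: fgn_autocov_0 power2_eq_square)
  \<comment> \<open>The Bochner integral of a non-integrable function is 0 by convention, so the
    value 1 certifies integrability.\<close>
  then show "integrable M (\<lambda>\<omega>. (X t \<omega>)\<^sup>2)"
    using not_integrable_integral_eq by fastforce
qed

text \<open>The factor L^(-H) exactly undoes the growth L^(2H) of the variance, so under no shift
  every scale has the same standard normal law.\<close>

lemma fgn_aggregate_std_normal:
  assumes fgn: "fractional_gaussian_noise H M X" and "1 \<le> L"
  shows "distributed M lborel (aggregate H L X i) std_normal_density"
proof -
  interpret prob_space M
    using fgn by (simp add: fractional_gaussian_noise_def gaussian_process_def)
  note [measurable] = fgn_square_integrable(1)[OF fgn]
  note sq = fgn_square_integrable(2)[OF fgn]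
  \<comment> \<open>First moments and products must be integrable before expectation can be
    exchanged with the sums.\<close>
  have int1: "integrable M (X t)" for t
    by (rule square_integrable_imp_integrable[OF _ sq]) simp
  have int2: "integrable M (\<lambda>\<omega>. X s \<omega> * X t \<omega>)" for s t
  proof (rule Bochner_Integration.integrable_bound)
    show "integrable M (\<lambda>\<omega>. (X s \<omega>)\<^sup>2 + (X t \<omega>)\<^sup>2)" using sq by simp
    have "\<bar>x * y\<bar> \<le> x\<^sup>2 + y\<^sup>2" for x y :: real
    proof -
      have "\<bar>x * y\<bar> \<le> 2 * \<bar>x\<bar> * \<bar>y\<bar>" by (simp add: abs_mult)
      also have "\<dots> \<le> \<bar>x\<bar>\<^sup>2 + \<bar>y\<bar>\<^sup>2" by (rule sum_squares_bound)
      finally show ?thesis by simp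
    qed
    then show "AE \<omega> in M. norm (X s \<omega> * X t \<omega>) \<le> norm ((X s \<omega>)\<^sup>2 + (X t \<omega>)\<^sup>2)"
      by simp
  qed simp
  define r where "r = real L powr (- H)"
  have agg: "aggregate H L X i = (\<lambda>\<omega>. r * (\<Sum>j<L. X (i - int j) \<omega>))"
    by (simp add: aggregate_def r_def fun_eq_iff)
  \<comment> \<open>The definition of a Gaussian process speaks of sums over finite sets of times,
    so the window is rewritten as an injective image.\<close>
  have "(\<lambda>\<omega>. \<Sum>t\<in>(\<lambda>j. i - int j) ` {..<L}. r * X t \<omega>) = aggregate H L X i"
    unfolding agg by (subst sum.reindex) (auto simp: inj_on_def sum_distrib_left)
  moreover have "gaussian_rv M (\<lambda>\<omega>. \<Sum>t\<in>(\<lambda>j. i - int j) ` {..<L}. r * X t \<omega>)"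
    by (rule fgn_gaussian_rv[OF fgn]) simp
  ultimately have rv: "gaussian_rv M (aggregate H L X i)" by simp
  have m: "integral\<^sup>L M (aggregate H L X i) = 0"
    using fgn int1 by (simp add: agg fractional_gaussian_noise_def)
  have "integral\<^sup>L M (\<lambda>\<omega>. (aggregate H L X i \<omega>)\<^sup>2)
      = integral\<^sup>L M (\<lambda>\<omega>. r\<^sup>2 * (\<Sum>k<L. \<Sum>j<L. X (i - int k) \<omega> * X (i - int j) \<omega>))"
    by (simp only: agg power_mult_distrib power2_eq_square[of "sum _ _"] sum_product)
  also have "\<dots> = r\<^sup>2 * (\<Sum>k<L. \<Sum>j<L. fgn_autocov H (int j - int k))"
    using int2 by (simp add: fgn_covariance[OF fgn])
  also have "(\<Sum>k<L. \<Sum>j<L. fgn_autocov H (int j - int k)) = real L powr (2 * H)"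
    by (subst sum.swap) (rule sum_fgn_autocov)
  also have "r\<^sup>2 * real L powr (2 * H) = 1"
    using \<open>1 \<le> L\<close> by (simp add: r_def power2_eq_square powr_add[symmetric])
  finally show ?thesis
    using gaussian_rv_standard[OF prob_space_axioms rv m] by simp
qed

lemma fgn_std_normal:
  assumes "fractional_gaussian_noise H M X"
  shows "distributed M lborel (X i) std_normal_density"
proof -
  have "aggregate H 1 X i = X i" by (simp add: aggregate_def fun_eq_iff)
  then show ?thesis using fgn_aggregate_std_normal[OF assms, of 1 i] by simp
qed

section \<open>Effect of the shift on the aggregate, and the power comparison\<close>

lemma aggregate_mean_shift:
  "aggregate H L (mean_shift a0 a1 d X) i \<omega>
    = aggregate H L X i \<omega> + d * (real L powr - H * (\<Sum>j<L. indicator {a0..a1} (i - int j)))"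
  by (simp add: aggregate_def mean_shift_def sum.distrib sum_distrib_left algebra_simps)

text \<open>Only j <= i - a0 reaches the shifted stretch, so the count is bounded independently of L
  and the mean of the aggregate decays like L^(-H).\<close>

lemma sum_indicator_le:
  fixes i a0 a1 :: int
  assumes "a0 \<le> i"
  shows "(\<Sum>j<L. indicator {a0..a1} (i - int j) :: real) \<le> real_of_int (i - a0 + 1)"
proof -
  have "(\<Sum>j<L. indicator {a0..a1} (i - int j) :: real) \<le> (\<Sum>j<L. indicator {..nat (i - a0)} j)"
    using assms by (intro sum_mono) (auto simp: indicator_def)
  also have "\<dots> = real (card ({..<L} \<inter> {..nat (i - a0)}))"
    by (simp add: indicator_def sum.If_cases Int_def)
  also have "\<dots> \<le> real (card {..nat (i - a0)})"
    by (intro of_nat_mono card_mono) auto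
  also have "\<dots> = real_of_int (i - a0 + 1)" using assms by simp
  finally show ?thesis .
qed

theorem theorem1:
  fixes H \<delta> :: real and a0 a1 i :: int
  assumes "0 < H" and "H < 1"
    and "a0 \<le> i" and "i \<le> a1"
    and "\<delta> > 0"
  shows "\<exists>\<alpha>\<^sub>\<delta> L\<^sub>\<delta> :: real. 0 < \<alpha>\<^sub>\<delta> \<and> \<alpha>\<^sub>\<delta> < 1 \<and> L\<^sub>\<delta> > 0 \<and>
    (\<forall>(M :: 'a measure) X. fractional_gaussian_noise H M X \<longrightarrow>
      (\<forall>(\<alpha> :: real) (L :: nat) (C :: real).
        let Y0 = mean_shift a0 a1 0 X;
            Y1 = mean_shift a0 a1 \<delta> X;
            \<beta>1L = two_scale_prob M (Y1 i) (aggregate H L Y1 i) C;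
            \<beta>1 = one_scale_prob M (Y1 i) (one_scale_threshold \<alpha>);
            \<beta>L = one_scale_prob M (aggregate H L Y1 i) (one_scale_threshold \<alpha>)
        in 0 < \<alpha> \<longrightarrow> \<alpha> < \<alpha>\<^sub>\<delta> \<longrightarrow> L \<ge> 2 \<longrightarrow> real L > L\<^sub>\<delta> \<longrightarrow>
           C > 0 \<longrightarrow> two_scale_prob M (Y0 i) (aggregate H L Y0 i) C = \<alpha> \<longrightarrow>
           \<beta>1L \<ge> (\<beta>1 + \<beta>L) / 2))"
proof -
  obtain C0 where "0 < C0" and C0: "\<And>D c m. \<lbrakk>C0 \<le> D; D \<le> c; normal_tail D \<le> 2 * normal_tail c;
      0 \<le> m; m \<le> \<delta> / 2\<rbrakk> \<Longrightarrow> normal_tail (D - \<delta>) + normal_tail (D + \<delta>)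
        + (normal_tail (D - m) + normal_tail (D + m)) \<le> 2 * normal_tail (c - \<delta>)"
    using two_scale_tail_comparison[OF \<open>\<delta> > 0\<close>] by blast
  define K where "K = real_of_int (i - a0 + 1)"
  have "1 \<le> K" using \<open>a0 \<le> i\<close> by (simp add: K_def)
  \<comment> \<open>Since the tail at D equals \<alpha>/2, a level below twice the tail at C0 forces
    D >= C0; the 1/2 keeps the level below 1.\<close>
  define A where "A = min (1 / 2) (2 * normal_tail C0)"
  \<comment> \<open>L > B gives L^H >= 2 K, which bounds the mean of the aggregate by
    \<delta>/2.\<close>
  define B where "B = (2 * K) powr (1 / H)"
  have "0 < normal_tail C0"
    using less_le_trans[OF _ normal_tail_ge_exp[of C0 1]] measure_stdN_Ioc_pos[of 0 1] \<open>0 < C0\<close> by simp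
  show ?thesis
    unfolding Let_def
  proof (rule exI[of _ A], rule exI[of _ B], intro conjI allI impI)
    show "0 < A" "A < 1" "0 < B"
      using \<open>0 < normal_tail C0\<close> \<open>1 \<le> K\<close> by (auto simp: A_def B_def)
    fix M :: "'a measure" and X :: "int \<Rightarrow> 'a \<Rightarrow> real" and \<alpha> C :: real and L :: nat
    assume fgn: "fractional_gaussian_noise H M X"
      and "0 < \<alpha>" "\<alpha> < A" "2 \<le> L" "B < real L" "0 < C"
      and level: "two_scale_prob M (mean_shift a0 a1 0 X i)
        (aggregate H L (mean_shift a0 a1 0 X) i) C = \<alpha>"
    interpret prob_space M
      using fgn by (simp add: fractional_gaussian_noise_def gaussian_process_def)
    note U = fgn_std_normal[OF fgn, of i]
    have V: "distributed M lborel (aggregate H L X i) std_normal_density"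
      using fgn_aggregate_std_normal[OF fgn] \<open>2 \<le> L\<close> by simp
    have [measurable]: "X i \<in> borel_measurable M" "aggregate H L X i \<in> borel_measurable M"
      using U V by (simp_all add: distributed_def)
    define D where "D = one_scale_threshold \<alpha>"
    define m where "m = \<delta> * (real L powr - H * (\<Sum>j<L. indicator {a0..a1} (i - int j)))"
    have Y0: "mean_shift a0 a1 0 X i = X i" "aggregate H L (mean_shift a0 a1 0 X) i = aggregate H L X i"
      by (simp_all add: fun_eq_iff mean_shift_def aggregate_def)
    have Y1: "mean_shift a0 a1 \<delta> X i = (\<lambda>\<omega>. X i \<omega> + \<delta>)"
        "aggregate H L (mean_shift a0 a1 \<delta> X) i = (\<lambda>\<omega>. aggregate H L X i \<omega> + m)"
      using \<open>a0 \<le> i\<close> \<open>i \<le> a1\<close>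
      by (simp_all add: fun_eq_iff aggregate_mean_shift m_def) (simp add: mean_shift_def)
    have tD: "normal_tail D = \<alpha> / 2"
      unfolding D_def using \<open>0 < \<alpha>\<close> \<open>\<alpha> < A\<close> by (intro normal_tail_one_scale_threshold) (auto simp: A_def)
    have "C0 \<le> D"
    proof (rule ccontr)
      assume "\<not> C0 \<le> D"
      then have "normal_tail C0 \<le> normal_tail D" by (intro normal_tail_antimono) auto
      with \<open>\<alpha> < A\<close> tD show False by (auto simp: A_def)
    qed
    have "0 \<le> D" using \<open>C0 \<le> D\<close> \<open>0 < C0\<close> by simp
    have m: "0 \<le> m" "m \<le> \<delta> / 2"
    proof -
      show "0 \<le> m" unfolding m_def using \<open>0 < \<delta>\<close> by (auto intro!: mult_nonneg_nonneg sum_nonneg)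
      have "2 * K = B powr H" using \<open>1 \<le> K\<close> \<open>0 < H\<close> by (simp add: B_def powr_powr)
      also have "\<dots> \<le> real L powr H"
        using \<open>B < real L\<close> \<open>0 < H\<close> \<open>0 < B\<close> by (intro powr_mono2) auto
      finally have K: "2 * K \<le> real L powr H" .
      have "real L powr - H * (\<Sum>j<L. indicator {a0..a1} (i - int j)) \<le> real L powr - H * K"
        unfolding K_def using sum_indicator_le[OF \<open>a0 \<le> i\<close>] by (intro mult_left_mono) auto
      also have "\<dots> \<le> 1 / 2"
        using K \<open>2 \<le> L\<close> by (simp add: powr_minus field_simps)
      finally show "m \<le> \<delta> / 2" unfolding m_def using \<open>0 < \<delta>\<close> mult_left_mono by fastforce
    qed
    \<comment> \<open>Union bound; each scale contributes twice the tail at C.\<close>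
    have "\<alpha> \<le> one_scale_prob M (X i) C + one_scale_prob M (aggregate H L X i) C"
    proof -
      have "{\<omega> \<in> space M. max \<bar>X i \<omega>\<bar> \<bar>aggregate H L X i \<omega>\<bar> > C}
          = {\<omega> \<in> space M. \<bar>X i \<omega>\<bar> > C} \<union> {\<omega> \<in> space M. \<bar>aggregate H L X i \<omega>\<bar> > C}"
        by auto
      then show ?thesis
        using level by (auto simp: Y0 two_scale_prob_def one_scale_prob_def
            intro!: measure_Un_le)
    qed
    also have "\<dots> = 4 * normal_tail C"
      using one_scale_prob_std_normal[OF prob_space_axioms U, of C 0]
        one_scale_prob_std_normal[OF prob_space_axioms V, of C 0] \<open>0 < C\<close> by simp
    finally have "normal_tail D \<le> 2 * normal_tail C" using tD by simp
    \<comment> \<open>The comparison lemma wants a point at or beyond D, which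
      \<open>max C D\<close> supplies. If it equals D, the bound is immediate; passing back to C
      afterwards only enlarges the tail.\<close>
    then have half: "normal_tail D \<le> 2 * normal_tail (max C D)"
      using tD \<open>0 < \<alpha>\<close> by (simp add: max_def)
    have "one_scale_prob M (\<lambda>\<omega>. X i \<omega> + \<delta>) D + one_scale_prob M (\<lambda>\<omega>. aggregate H L X i \<omega> + m) D
        = normal_tail (D - \<delta>) + normal_tail (D + \<delta>) + (normal_tail (D - m) + normal_tail (D + m))"
      using one_scale_prob_std_normal[OF prob_space_axioms U \<open>0 \<le> D\<close>]
        one_scale_prob_std_normal[OF prob_space_axioms V \<open>0 \<le> D\<close>] by simp
    also have "\<dots> \<le> 2 * normal_tail (max C D - \<delta>)"
      using half m \<open>C0 \<le> D\<close> by (intro C0) auto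
    also have "\<dots> \<le> 2 * (normal_tail (C - \<delta>) + normal_tail (C + \<delta>))"
      using normal_tail_antimono[of "C - \<delta>" "max C D - \<delta>"]
      by (simp add: add_increasing2 normal_tail_def)
    also have "normal_tail (C - \<delta>) + normal_tail (C + \<delta>) = one_scale_prob M (\<lambda>\<omega>. X i \<omega> + \<delta>) C"
      using one_scale_prob_std_normal[OF prob_space_axioms U] \<open>0 < C\<close> by simp
    also have "\<dots> \<le> two_scale_prob M (\<lambda>\<omega>. X i \<omega> + \<delta>) (\<lambda>\<omega>. aggregate H L X i \<omega> + m) C"
      unfolding one_scale_prob_def two_scale_prob_def
      by (intro finite_measure_mono) auto
    finally show "(one_scale_prob M (mean_shift a0 a1 \<delta> X i) (one_scale_threshold \<alpha>)
        + one_scale_prob M (aggregate H L (mean_shift a0 a1 \<delta> X) i) (one_scale_threshold \<alpha>)) / 2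
      \<le> two_scale_prob M (mean_shift a0 a1 \<delta> X i) (aggregate H L (mean_shift a0 a1 \<delta> X) i) C"
      by (simp add: Y1 D_def)
  qed
qed

end
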